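(* Let $n\ge 2$ be an integer and $D\subseteq\{d : d\mid n,\ 1\le d<n\}$. The integral circulant graph $\mathrm{ICG}_n(D)$ has perfect state transfer if and only if all of the following hold: $n$ is divisible by $4$; $D_1^*=2D_2^*$; $D_0=4D_2^*$; and either $n/4\in D$ or $n/2\in D$. Here $D_2^*=D_2\setminus\{n/4\}$ and $D_1^*=D_1\setminus\{n/2\}$.
   Context: For a set $D$ of divisors of $n$ with $D\subseteq\{d : d\mid n,\ 1\le d<n\}$, the integral circulant graph $\mathrm{ICG}_n(D)$ has vertex set $\mathbb{Z}_n=\{0,1,\dots,n-1\}$, and vertices $a,b$ are adjacent iff $\gcd(a-b,n)\in D$. Let $A$ be its adjacency matrix and $F(t)=\exp(\mathrm{i}At)$. The graph has perfect state transfer (PST) if there exist distinct vertices $a,b$ and a real $\tau>0$ with $|F(\tau)_{ab}|=1$. For a positive integer $m$, $S_2(m)$ denotes the largest $\alpha$ with $2^\alpha\mid m$. For $i\ge 0$ let $D_i=\{d\in D : S_2(n/d)=i\}$. For a positive integer $k$ and a set $E$ of integers, $kE=\{ke : e\in E\}$.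
   Formalization: The case n ≡ 2 (mod 4) with D = {n/2} is excluded: there the graph is a disjoint union of edges and has PST at time π/2 although 4 does not divide n (e.g. n = 2, D = {1}). "Either n/4 ∈ D or n/2 ∈ D" is read as exclusive. *)

theory Defs
  imports "HOL-Analysis.Analysis" "Jordan_Normal_Form.Matrix"
begin

definition icg_vertices :: "nat \<Rightarrow> nat set" where
  "icg_vertices n = {0..<n}"

text \<open>The difference of two vertices is taken in the integers, not in the truncating naturals.\<close>

definition icg_adj :: "nat \<Rightarrow> nat set \<Rightarrow> nat \<Rightarrow> nat \<Rightarrow> bool" where
  "icg_adj n D a b \<longleftrightarrow> nat (gcd (int a - int b) (int n)) \<in> D"

definition icg_matrix :: "nat \<Rightarrow> nat set \<Rightarrow> complex mat" where
  "icg_matrix n D = mat n n (\<lambda>(a, b). if icg_adj n D a b then 1 else 0)"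

text \<open>The exponential of a square matrix, as the entrywise sum of its power series;
  over the complex numbers every entry converges absolutely.\<close>

definition mat_exp :: "complex mat \<Rightarrow> complex mat" where
  "mat_exp M = mat (dim_row M) (dim_row M) (\<lambda>(a, b). \<Sum>k. (M ^\<^sub>m k) $$ (a, b) / fact k)"

definition icg_transfer :: "nat \<Rightarrow> nat set \<Rightarrow> real \<Rightarrow> complex mat" where
  "icg_transfer n D t = mat_exp ((\<i> * complex_of_real t) \<cdot>\<^sub>m icg_matrix n D)"

definition has_pst :: "nat \<Rightarrow> nat set \<Rightarrow> bool" where
  "has_pst n D \<longleftrightarrow>
     (\<exists>a\<in>icg_vertices n. \<exists>b\<in>icg_vertices n. a \<noteq> b \<and>
        (\<exists>\<tau>::real. \<tau> > 0 \<and> cmod (icg_transfer n D \<tau> $$ (a, b)) = 1))"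

text \<open>A pitfall: for \<open>D = {n div 2}\<close> the graph is a disjoint union of single edges (a single edge if
  \<open>n = 2\<close>), which has perfect state transfer at time \<open>pi / 2\<close> for every even \<open>n\<close>. For
  \<open>n mod 4 = 2\<close> this is incompatible with a characterization that forces \<open>4 dvd n\<close>, so this
  case has to be excluded there.\<close>

definition S2 :: "nat \<Rightarrow> nat" where
  "S2 m = multiplicity 2 m"

definition div_class :: "nat \<Rightarrow> nat set \<Rightarrow> nat \<Rightarrow> nat set" where
  "div_class n D i = {d \<in> D. S2 (n div d) = i}"

text \<open>The two starred classes agree with the intended ones only if the removed quotient is an
  exact one; they are used for \<open>n\<close> divisible by \<open>4\<close>.\<close>

definition D1_star :: "nat \<Rightarrow> nat set \<Rightarrow> nat set" where
  "D1_star n D = div_class n D 1 - {n div 2}"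

definition D2_star :: "nat \<Rightarrow> nat set \<Rightarrow> nat set" where
  "D2_star n D = div_class n D 2 - {n div 4}"

definition set_scale :: "nat \<Rightarrow> nat set \<Rightarrow> nat set" where
  "set_scale k E = {k * e | e. e \<in> E}"

end

theory Submission
  imports Defs
begin

text \<open>Write \<open>F q = 1\<close> if \<open>q\<close> divides \<open>n\<close> and \<open>n/q \<in> D\<close>, and \<open>F q = 0\<close> otherwise. Moebius inversion
  along the multiples of \<open>q\<close> gives integers \<open>K d\<close> with \<open>F q = (\<Sum>q | d | n. K d)\<close>. Then the
  adjacency indicator is the combination of the subgroups \<open>(n/d)\<int>\<close> with weights \<open>K d\<close>, so the
  eigenvalues are the integers \<open>\<lambda>\<^sub>j = (\<Sum>d | gcd(j, n). d * K d)\<close>; no Ramanujan sums are needed.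

  Perfect state transfer at time \<open>t\<close> forces the two vertices to be antipodal and
  \<open>exp(i t (\<lambda>\<^sub>j - \<lambda>\<^sub>0)) = (-1)^j\<close>, that is \<open>\<lambda>\<^sub>j \<equiv> \<lambda>\<^sub>0 + 2^c j\<close> modulo \<open>2^(c+1)\<close> for some \<open>c\<close>. Taking
  \<open>j = r\<close> and \<open>j = 2r\<close> with \<open>r\<close> odd and inducting over divisors, \<open>K r\<close> and \<open>2 K (2r)\<close> vanish modulo
  \<open>2^(c+1)\<close> for \<open>r > 1\<close>, while \<open>2 K 2 \<equiv> 2^c\<close>; hence \<open>c \<ge> 1\<close>. Since \<open>F\<close> only takes the values 0
  and 1, this gives \<open>F r = F (2r) = F (4r)\<close> for odd \<open>r > 1\<close> and \<open>F 2 \<noteq> F 4\<close>. Conversely these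
  equations make \<open>K r\<close> and \<open>K (2r)\<close> vanish for odd \<open>r > 1\<close> and \<open>K 2 = \<plusminus>1\<close>, so that
  \<open>\<lambda>\<^sub>j + 2j \<equiv> K 1 + 2\<close> modulo 4 for all \<open>j\<close>, and the transfer happens at time \<open>\<pi>/2\<close>.\<close>

section \<open>Integer eigenvalues\<close>

text \<open>The bound \<open>d' \<le> n\<close> only serves termination; it also makes the sum finite for \<open>n = 0\<close>.\<close>

function upper_moebius :: "nat \<Rightarrow> (nat \<Rightarrow> int) \<Rightarrow> nat \<Rightarrow> int" where
  "upper_moebius n F d =
     F d - (\<Sum>d' | d' dvd n \<and> d dvd d' \<and> d < d' \<and> d' \<le> n. upper_moebius n F d')"
  by auto
termination by (relation "Wellfounded.measure (\<lambda>(n, F, d). n - d)") auto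

declare upper_moebius.simps [simp del]

text \<open>One unfolding of the recursion at \<open>q\<close> suffices: the summand at
  \<open>d = q\<close> is \<open>F q\<close> minus all the other summands.\<close>

lemma sum_upper_moebius:
  assumes "n > 0" "q dvd n"
  shows "(\<Sum>d | d dvd n \<and> q dvd d. upper_moebius n F d) = F q"
proof -
  have eq: "{d. d dvd n \<and> q dvd d} = insert q {d. d dvd n \<and> q dvd d \<and> q < d \<and> d \<le> n}"
    using assms by (auto dest: dvd_imp_le intro: Nat.gr0I)
      (metis dvd_imp_le dvd_pos_nat le_neq_implies_less)
  have "finite {d. d dvd n \<and> q dvd d \<and> q < d \<and> d \<le> n}"
    by (rule finite_subset[of _ "{..n}"]) auto
  then show ?thesis
    unfolding eq by (subst sum.insert) (auto simp: upper_moebius.simps[of n F q])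
qed

text \<open>The guard \<open>q dvd n\<close> keeps out quotients that land in \<open>D\<close> only
  by rounding, so the value is 0 off the divisors of \<open>n\<close> and equations such as
  \<open>F (2 * r) = F (4 * r)\<close> make sense for every \<open>r\<close>.\<close>

definition icg_codivisor :: "nat \<Rightarrow> nat set \<Rightarrow> nat \<Rightarrow> int" where
  "icg_codivisor n D q = of_bool (q dvd n \<and> n div q \<in> D)"

definition icg_coeff :: "nat \<Rightarrow> nat set \<Rightarrow> nat \<Rightarrow> int" where
  "icg_coeff n D = upper_moebius n (icg_codivisor n D)"

text \<open>At \<open>j = 0\<close> every divisor of \<open>n\<close> contributes, which gives the
  degree of the graph; the value at \<open>j = n\<close> is the same.\<close>

definition icg_eigenvalue :: "nat \<Rightarrow> nat set \<Rightarrow> nat \<Rightarrow> int" where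
  "icg_eigenvalue n D j = (\<Sum>d | d dvd n \<and> d dvd j. int d * icg_coeff n D d)"

lemma sum_icg_coeff:
  assumes "n > 0"
  shows "(\<Sum>d | d dvd n \<and> q dvd d. icg_coeff n D d) = icg_codivisor n D q"
proof (cases "q dvd n")
  case True
  then show ?thesis using assms by (simp add: icg_coeff_def sum_upper_moebius)
next
  case False
  then have "{d. d dvd n \<and> q dvd d} = {}" using dvd_trans by blast
  with False show ?thesis by (simp add: icg_codivisor_def del: Collect_empty_eq)
qed

text \<open>With \<open>g\<close> the gcd of \<open>a - b\<close> and \<open>n\<close>, the quotient
  \<open>q = n / g\<close> is the additive order of \<open>a - b\<close> modulo \<open>n\<close>.
  Thus \<open>d\<close> annihilates the difference iff \<open>q dvd d\<close>, and the sum collapses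
  to the codivisor indicator at \<open>q\<close>.\<close>

lemma icg_adj_eq_sum_coeff:
  assumes "n > 0"
  shows "(of_bool (icg_adj n D a b) :: int) =
    (\<Sum>d | d dvd n \<and> int n dvd int d * (int a - int b). icg_coeff n D d)"
proof -
  define x where "x = int a - int b"
  define g where "g = nat (gcd x (int n))"
  have g: "int g = gcd x (int n)" by (simp add: g_def)
  have "int g dvd int n" by (simp add: g)
  then have gn: "g dvd n" by simp
  then obtain q where q: "n = g * q" by blast
  have pos: "g > 0" "q > 0" using q assms by (auto intro: Nat.gr0I)
  have "q dvd d \<longleftrightarrow> int n dvd int d * x" for d
  proof -
    have "q dvd d \<longleftrightarrow> n dvd d * g" using q pos by (simp add: mult.commute)
    also have "\<dots> \<longleftrightarrow> int n dvd int d * int g" by (metis of_nat_dvd_iff of_nat_mult)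
    also have "int d * int g = gcd (int d * x) (int d * int n)"
      by (simp add: g gcd_mult_left)
    also have "int n dvd \<dots> \<longleftrightarrow> int n dvd int d * x" by simp
    finally show ?thesis .
  qed
  then have "(\<Sum>d | d dvd n \<and> int n dvd int d * x. icg_coeff n D d) = icg_codivisor n D q"
    using sum_icg_coeff[OF assms, where q = q and D = D] by simp
  also have "\<dots> = of_bool (g \<in> D)" using q pos by (simp add: icg_codivisor_def)
  finally show ?thesis by (simp add: icg_adj_def g_def x_def)
qed

section \<open>Diagonalization and the transfer matrix\<close>

definition root_char :: "nat \<Rightarrow> int \<Rightarrow> complex" where
  "root_char n x = cis (2 * pi * real_of_int x / real n)"

lemma root_char_add: "root_char n (x + y) = root_char n x * root_char n y"
  by (simp add: root_char_def cis_mult algebra_simps add_divide_distrib)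

lemma root_char_0 [simp]: "root_char n 0 = 1"
  by (simp add: root_char_def)

lemma norm_root_char [simp]: "cmod (root_char n x) = 1"
  by (simp add: root_char_def)

lemma root_char_power: "root_char n x ^ k = root_char n (int k * x)"
  unfolding root_char_def Complex.DeMoivre by (rule arg_cong[where f = cis]) simp

lemma root_char_eq_1_iff:
  assumes "n > 0"
  shows "root_char n x = 1 \<longleftrightarrow> int n dvd x"
proof
  assume "root_char n x = 1"
  then have "cos (2 * pi * real_of_int x / real n) = 1"
    by (simp add: root_char_def complex_eq_iff)
  then obtain k where "2 * pi * real_of_int x / real n = real_of_int k * 2 * pi"
    using cos_one_2pi_int by blast
  then have "real_of_int x = real_of_int (k * int n)"
    using assms by (simp add: field_simps)
  then have "x = k * int n" by (simp only: of_int_eq_iff)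
  then show "int n dvd x" by simp
next
  assume "int n dvd x"
  then obtain k where "x = int n * k" by blast
  then have "2 * pi * real_of_int x / real n = 2 * pi * real_of_int k"
    using assms by simp
  then show "root_char n x = 1"
    by (simp only: root_char_def cis_multiple_2pi[OF Ints_of_int])
qed

lemma sum_root_char:
  assumes "n > 0"
  shows "(\<Sum>k<n. root_char n (int k * x)) = of_bool (int n dvd x) * of_nat n"
proof (cases "int n dvd x")
  case True
  then have "root_char n (int k * x) = 1" for k
    using assms by (simp add: root_char_eq_1_iff)
  with True show ?thesis by simp
next
  case False
  then have "root_char n x \<noteq> 1" using assms by (simp add: root_char_eq_1_iff)
  moreover have "root_char n x ^ n = 1"
    using assms by (simp add: root_char_power root_char_eq_1_iff)
  ultimately show ?thesis using False by (simp add: root_char_power[symmetric] geometric_sum)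
qed

text \<open>Raising \<open>b\<close> by one changes the sum by a telescoping difference, whose two
  boundary terms agree by periodicity.\<close>

lemma sum_periodic_shift:
  fixes p :: "int \<Rightarrow> complex"
  assumes "\<And>x. p (x + int n) = p x"
  shows "(\<Sum>c<n. p (int c - int b)) = (\<Sum>c<n. p (int c))"
proof (induction b)
  case (Suc b)
  have "(\<Sum>c<n. p (int (Suc c) - int (Suc b)) - p (int c - int (Suc b))) =
      p (int n - int (Suc b)) - p (int 0 - int (Suc b))"
    by (rule sum_lessThan_telescope)
  also have "\<dots> = 0"
    using assms[of "- int (Suc b)"] by (simp add: algebra_simps)
  finally show ?case using Suc by (simp add: sum_subtractf)
qed simp

text \<open>The index set is the subgroup of multiples of \<open>e = n / d\<close>. On it the
  character becomes a character modulo \<open>d\<close>, and orthogonality over a full period of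
  length \<open>d\<close> applies.\<close>

lemma sum_subgroup_char:
  assumes "n > 0" "d dvd n"
  shows "(\<Sum>x | x < n \<and> int n dvd int d * int x. root_char n (int j * int x)) =
    of_nat d * of_bool (d dvd j)"
proof -
  obtain e where e: "n = d * e" using assms by blast
  have pos: "d > 0" "e > 0" using e assms by (auto intro: Nat.gr0I)
  have "{x. x < n \<and> int n dvd int d * int x} = (\<lambda>y. e * y) ` {..<d}"
  proof (intro equalityI subsetI)
    fix x assume x: "x \<in> {x. x < n \<and> int n dvd int d * int x}"
    then have "n dvd d * x" by (metis (mono_tags) mem_Collect_eq of_nat_dvd_iff of_nat_mult)
    then have "e dvd x" using e pos by simp
    then obtain y where "x = e * y" by blast
    with x e pos show "x \<in> (\<lambda>y. e * y) ` {..<d}" by auto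
  qed (use e pos in auto)
  moreover have "inj_on (\<lambda>y. e * y) {..<d}" using pos by (auto intro: inj_onI)
  ultimately have "(\<Sum>x | x < n \<and> int n dvd int d * int x. root_char n (int j * int x)) =
      (\<Sum>y<d. root_char n (int j * int (e * y)))"
    by (simp add: sum.reindex)
  also have "\<dots> = (\<Sum>y<d. root_char d (int y * int j))"
    using e pos by (intro sum.cong) (simp_all add: root_char_def field_simps)
  finally show ?thesis using pos by (simp add: sum_root_char)
qed

text \<open>The characters are eigenvectors: the adjacency indicator splits into subgroup
  indicators, periodicity moves the base vertex \<open>b\<close> to 0, and each subgroup contributes
  \<open>d\<close> or 0.\<close>

lemma sum_adj_root_char:
  assumes "n > 0" "b < n"
  shows "(\<Sum>c<n. (if icg_adj n D c b then 1 else 0) * root_char n (int j * (int c - int b))) =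
    of_int (icg_eigenvalue n D j)"
proof -
  let ?S = "{d. d dvd n}"
  have fin: "finite ?S" using assms by simp
  define p where "p d x = of_bool (int n dvd int d * x) * root_char n (int j * x)" for d x
  have per: "p d (x + int n) = p d x" for d x
  proof -
    have "root_char n (int j * int n) = 1" using assms by (simp add: root_char_eq_1_iff)
    then show ?thesis
      by (simp add: p_def distrib_left root_char_add)
  qed
  have "(\<Sum>c<n. (if icg_adj n D c b then 1 else 0) * root_char n (int j * (int c - int b))) =
      (\<Sum>c<n. \<Sum>d\<in>?S. of_int (icg_coeff n D d) * p d (int c - int b))"
  proof (intro sum.cong refl)
    fix c
    have "(if icg_adj n D c b then 1 else 0 :: complex) = of_int (of_bool (icg_adj n D c b))" by simp
    also have "\<dots> = (\<Sum>d\<in>?S. of_int (icg_coeff n D d) * of_bool (int n dvd int d * (int c - int b)))"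
      unfolding icg_adj_eq_sum_coeff[OF assms(1)] of_int_sum
      using fin by (intro sum.mono_neutral_cong_left) auto
    finally show "(if icg_adj n D c b then 1 else 0) * root_char n (int j * (int c - int b)) =
        (\<Sum>d\<in>?S. of_int (icg_coeff n D d) * p d (int c - int b))"
      by (simp add: p_def sum_distrib_right mult.assoc)
  qed
  also have "\<dots> = (\<Sum>d\<in>?S. of_int (icg_coeff n D d) * (\<Sum>c<n. p d (int c - int b)))"
    by (subst sum.swap) (simp add: sum_distrib_left)
  also have "\<dots> = (\<Sum>d\<in>?S. of_int (icg_coeff n D d) * (\<Sum>c<n. p d (int c)))"
    using per by (simp add: sum_periodic_shift)
  also have "\<dots> = (\<Sum>d\<in>?S. of_int (icg_coeff n D d) * (of_nat d * of_bool (d dvd j)))"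
  proof (intro sum.cong refl arg_cong2[where f = "(*)"])
    fix d assume "d \<in> ?S"
    have "(\<Sum>c<n. p d (int c)) =
        (\<Sum>x | x < n \<and> int n dvd int d * int x. root_char n (int j * int x))"
      by (intro sum.mono_neutral_cong_right) (auto simp: p_def)
    with \<open>d \<in> ?S\<close> show "(\<Sum>c<n. p d (int c)) = of_nat d * of_bool (d dvd j)"
      using sum_subgroup_char[OF assms(1)] by simp
  qed
  also have "\<dots> = of_int (icg_eigenvalue n D j)"
    unfolding icg_eigenvalue_def of_int_sum
    using fin by (intro sum.mono_neutral_cong_right) auto
  finally show ?thesis .
qed

text \<open>Spectral decomposition, by induction on \<open>k\<close>. Orthogonality of the
  characters gives the identity matrix at \<open>k = 0\<close>. In the step,
  \<open>a - c = (a - b) - (c - b)\<close> splits off the conjugate of an eigenvalue sum, and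
  conjugation is harmless because the eigenvalue is an integer.\<close>

lemma icg_matrix_pow_entry:
  assumes "n > 0" "a < n" "b < n"
  shows "((x \<cdot>\<^sub>m icg_matrix n D) ^\<^sub>m k) $$ (a, b) =
    (\<Sum>j<n. (x * of_int (icg_eigenvalue n D j)) ^ k * root_char n (int j * (int a - int b))) / of_nat n"
  using assms(2, 3)
proof (induction k arbitrary: a b)
  case 0
  have "(\<Sum>j<n. root_char n (int j * (int a - int b))) =
      of_bool (int n dvd int a - int b) * of_nat n"
    by (rule sum_root_char[OF assms(1)])
  moreover have "int n dvd int a - int b \<longleftrightarrow> a = b"
    using 0 by (auto simp: mod_eq_dvd_iff[symmetric])
  ultimately show ?case using 0 assms by (simp add: icg_matrix_def)
next
  case (Suc k)
  let ?M = "x \<cdot>\<^sub>m icg_matrix n D"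
  let ?l = "\<lambda>j. x * of_int (icg_eigenvalue n D j)"
  have M: "?M \<in> carrier_mat n n" by (simp add: icg_matrix_def)
  have Mk: "?M ^\<^sub>m k \<in> carrier_mat n n" using M by (rule pow_carrier_mat)
  have "(?M ^\<^sub>m Suc k) $$ (a, b) = (\<Sum>c<n. (?M ^\<^sub>m k) $$ (a, c) * ?M $$ (c, b))"
    using carrier_matD[OF M] carrier_matD[OF Mk] Suc.prems
    by (simp add: scalar_prod_def lessThan_atLeast0)
  also have "\<dots> = (\<Sum>c<n. (\<Sum>j<n. ?l j ^ k * root_char n (int j * (int a - int c))) / of_nat n *
      (x * (if icg_adj n D c b then 1 else 0)))"
    using Suc by (intro sum.cong) (simp_all add: icg_matrix_def)
  also have "\<dots> = (\<Sum>c<n. \<Sum>j<n. ?l j ^ k * x * root_char n (int j * (int a - int b)) *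
      ((if icg_adj n D c b then 1 else 0) * cnj (root_char n (int j * (int c - int b))))) / of_nat n"
    unfolding sum_divide_distrib sum_distrib_right
  proof (intro sum.cong refl)
    fix c j
    have "root_char n (int j * (int a - int c)) =
        root_char n (int j * (int a - int b)) * cnj (root_char n (int j * (int c - int b)))"
      by (simp add: root_char_def cis_mult cis_cnj diff_divide_distrib algebra_simps)
    then show "?l j ^ k * root_char n (int j * (int a - int c)) / of_nat n *
        (x * (if icg_adj n D c b then 1 else 0)) =
      ?l j ^ k * x * root_char n (int j * (int a - int b)) *
        ((if icg_adj n D c b then 1 else 0) * cnj (root_char n (int j * (int c - int b)))) / of_nat n"
      by simp
  qed
  also have "\<dots> = (\<Sum>j<n. ?l j ^ k * x * root_char n (int j * (int a - int b)) *
      cnj (\<Sum>c<n. (if icg_adj n D c b then 1 else 0) * root_char n (int j * (int c - int b)))) / of_nat n"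
    by (subst sum.swap) (simp add: sum_distrib_left if_distrib[of cnj] cong: if_cong)
  also have "\<dots> = (\<Sum>j<n. ?l j ^ Suc k * root_char n (int j * (int a - int b))) / of_nat n"
    using Suc.prems by (subst sum_adj_root_char[OF assms(1)]) (simp_all add: mult_ac)
  finally show ?case .
qed

lemma icg_transfer_entry:
  assumes "n > 0" "a < n" "b < n"
  shows "icg_transfer n D t $$ (a, b) =
    (\<Sum>j<n. cis (t * of_int (icg_eigenvalue n D j)) * root_char n (int j * (int a - int b))) / of_nat n"
proof -
  let ?l = "\<lambda>j. \<i> * complex_of_real t * of_int (icg_eigenvalue n D j)"
  let ?w = "\<lambda>j. root_char n (int j * (int a - int b))"
  have "(\<lambda>k. ?l j ^ k / fact k) sums exp (?l j)" for j
    using exp_converges[of "?l j"] by (simp add: scaleR_conv_of_real field_simps)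
  then have "(\<lambda>k. (\<Sum>j<n. ?l j ^ k / fact k * ?w j) / of_nat n) sums
      ((\<Sum>j<n. exp (?l j) * ?w j) / of_nat n)"
    by (intro sums_divide sums_sum sums_mult2)
  moreover have "exp (?l j) = cis (t * of_int (icg_eigenvalue n D j))" for j
    by (simp add: cis_conv_exp mult_ac)
  moreover have "(((\<i> * complex_of_real t) \<cdot>\<^sub>m icg_matrix n D) ^\<^sub>m k) $$ (a, b) / fact k =
      (\<Sum>j<n. ?l j ^ k / fact k * ?w j) / of_nat n" for k
    using assms by (simp add: icg_matrix_pow_entry sum_divide_distrib mult_ac)
  ultimately show ?thesis
    using assms by (simp add: icg_transfer_def mat_exp_def icg_matrix_def sums_iff)
qed


section \<open>Two-adic analysis of the eigenvalues\<close>

text \<open>Triangular inversion modulo \<open>M\<close>: by strong induction the proper divisors of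
  \<open>r\<close> contribute 0, leaving \<open>r * W r\<close>, from which the odd factor cancels.
  \<open>W\<close> is kept general to serve both for \<open>K d\<close> and for
  \<open>2 * K (2 * d)\<close>.\<close>

lemma cong_coeffs_of_cong_divisor_sums:
  fixes W :: "nat \<Rightarrow> int" and M :: int
  assumes "\<And>l. odd l \<Longrightarrow> M dvd int l * W l \<Longrightarrow> M dvd W l"
    and "\<And>l. l dvd n \<Longrightarrow> odd l \<Longrightarrow> M dvd (\<Sum>d | d dvd l \<and> d \<noteq> 1. int d * W d)"
    and "n > 0" "r dvd n" "odd r" "r \<noteq> 1"
  shows "M dvd W r"
  using assms(4-6)
proof (induction r rule: less_induct)
  case (less r)
  let ?S = "{d. d dvd r \<and> d \<noteq> 1}"
  have "r > 0" using less.prems by (auto intro: Nat.gr0I)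
  then have fin: "finite ?S" by simp
  have "M dvd (\<Sum>d\<in>?S - {r}. int d * W d)"
  proof (intro dvd_sum dvd_mult less.IH)
    fix d assume d: "d \<in> ?S - {r}"
    then show "d < r" using \<open>r > 0\<close> by (auto dest: dvd_imp_le)
    show "d dvd n" using d less.prems by (auto intro: dvd_trans)
    show "odd d" using d less.prems by (auto dest: dvd_trans)
  qed (use less.prems in auto)
  moreover have "M dvd (\<Sum>d\<in>?S. int d * W d)" using assms(2) less.prems by simp
  moreover have "(\<Sum>d\<in>?S. int d * W d) = int r * W r + (\<Sum>d\<in>?S - {r}. int d * W d)"
    using fin less.prems by (intro sum.remove) auto
  ultimately have "M dvd int r * W r" by (simp add: dvd_add_left_iff)
  then show ?case using assms(1) less.prems by blast
qed

text \<open>For odd \<open>r\<close>, the divisors of \<open>2 * r\<close> that do not divide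
  \<open>r\<close> are exactly the doubles of the divisors of \<open>r\<close>.\<close>

lemma eigenvalue_even_minus_odd:
  assumes "n > 0" "even n" "r dvd n" "odd r"
  shows "icg_eigenvalue n D (2 * r) - icg_eigenvalue n D r =
    (\<Sum>d | d dvd r. int d * (2 * icg_coeff n D (2 * d)))"
proof -
  let ?A = "{d. d dvd n \<and> d dvd 2 * r}" and ?B = "{d. d dvd n \<and> d dvd r}"
  have "2 * r dvd n" using assms by (simp add: divides_mult)
  have "?A - ?B = (\<lambda>d. 2 * d) ` {d. d dvd r}"
  proof (intro equalityI subsetI)
    fix d assume d: "d \<in> ?A - ?B"
    have "even d"
    proof (rule ccontr)
      assume "odd d"
      then have "coprime d 2" by simp
      with d show False using coprime_dvd_mult_right_iff by blast
    qed
    then obtain e where "d = 2 * e" by blast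
    with d show "d \<in> (\<lambda>d. 2 * d) ` {d. d dvd r}" by auto
  next
    fix d assume "d \<in> (\<lambda>d. 2 * d) ` {d. d dvd r}"
    then obtain e where e: "d = 2 * e" "e dvd r" by blast
    then have "d dvd 2 * r" by simp
    moreover have "\<not> d dvd r" using e assms(4) by auto
    ultimately show "d \<in> ?A - ?B" using \<open>2 * r dvd n\<close> dvd_trans by blast
  qed
  moreover have "(\<Sum>d\<in>?A. int d * icg_coeff n D d) - (\<Sum>d\<in>?B. int d * icg_coeff n D d) =
      (\<Sum>d\<in>?A - ?B. int d * icg_coeff n D d)"
    using assms by (subst sum_diff) auto
  ultimately show ?thesis
    unfolding icg_eigenvalue_def
    by (simp add: sum.reindex inj_on_def mult_ac)
qed

lemma eigenvalue_minus_one: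
  assumes "n > 0" "r dvd n"
  shows "icg_eigenvalue n D r - icg_eigenvalue n D 1 =
    (\<Sum>d | d dvd r \<and> d \<noteq> 1. int d * icg_coeff n D d)"
proof -
  have "r > 0" using assms by (auto intro: Nat.gr0I)
  have "{d. d dvd n \<and> d dvd r} = {d. d dvd r}" using assms dvd_trans by blast
  moreover have "{d. d dvd n \<and> d dvd 1} = {1}" by auto
  moreover have "{d. d dvd r} - {1} = {d. d dvd r \<and> d \<noteq> 1}" by auto
  ultimately show ?thesis
    using \<open>r > 0\<close> by (simp add: icg_eigenvalue_def sum.remove[of "{d. d dvd r}" 1])
qed

text \<open>Passing from \<open>q\<close> to \<open>2 * q\<close> isolates the odd multiples of
  \<open>q\<close>.\<close>

lemma sum_icg_coeff_not_twice_dvd: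
  assumes "n > 0"
  shows "icg_codivisor n D q - icg_codivisor n D (2 * q) =
    (\<Sum>d | d dvd n \<and> q dvd d \<and> \<not> 2 * q dvd d. icg_coeff n D d)"
proof -
  have "{d. d dvd n \<and> q dvd d \<and> \<not> 2 * q dvd d} =
      {d. d dvd n \<and> q dvd d} - {d. d dvd n \<and> 2 * q dvd d}" by auto
  moreover have "{d. d dvd n \<and> 2 * q dvd d} \<subseteq> {d. d dvd n \<and> q dvd d}"
    using dvd_mult_right by blast
  ultimately show ?thesis
    using assms by (simp add: sum_diff sum_icg_coeff)
qed

text \<open>For odd \<open>r\<close>, the codivisor differences at \<open>r\<close> and
  \<open>2 * r\<close> are sums of coefficients at odd multiples, and these are the coefficients
  that the congruences at odd \<open>l\<close> and at \<open>2 * l\<close> control modulo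
  \<open>2 ^ Suc c\<close>.\<close>

lemma codivisor_if_eigenvalues_cong:
  assumes "n > 0" "even n"
    and cong: "\<And>j. j \<le> n \<Longrightarrow>
      2 ^ Suc c dvd icg_eigenvalue n D j - icg_eigenvalue n D 0 - 2 ^ c * int j"
  shows "icg_codivisor n D 2 \<noteq> icg_codivisor n D 4"
    and "odd r \<Longrightarrow> r \<noteq> 1 \<Longrightarrow> icg_codivisor n D r = icg_codivisor n D (2 * r)"
    and "odd r \<Longrightarrow> r \<noteq> 1 \<Longrightarrow> icg_codivisor n D (2 * r) = icg_codivisor n D (4 * r)"
proof -
  let ?l = "icg_eigenvalue n D" and ?K = "icg_coeff n D" and ?F = "icg_codivisor n D"
  define M :: int where "M = 2 ^ Suc c"
  have cop: "M dvd W" if "odd l" "M dvd int l * W" for l W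
  proof -
    have "coprime M (int l)" using that(1) by (simp add: M_def)
    with that(2) show ?thesis by (simp add: coprime_dvd_mult_right_iff)
  qed
  have M_even: "M dvd 2 ^ c * x" if "even x" for x
    using that by (auto simp: M_def elim!: evenE)
  have diff: "M dvd ?l i - ?l j - 2 ^ c * (int i - int j)" if "i \<le> n" "j \<le> n" for i j
  proof -
    have "M dvd (?l i - ?l 0 - 2 ^ c * int i) - (?l j - ?l 0 - 2 ^ c * int j)"
      unfolding M_def by (rule dvd_diff[OF cong cong]) (fact that)+
    then show ?thesis by (simp add: algebra_simps)
  qed
  have dvd_le: "l \<le> n" if "l dvd n" for l using assms(1) that by (simp add: dvd_imp_le)
  have even_le: "2 * l dvd n" if "l dvd n" "odd l" for l
    using that assms by (simp add: divides_mult)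
  have odd_coeff: "M dvd ?K r" if "r dvd n" "odd r" "r \<noteq> 1" for r
  proof (rule cong_coeffs_of_cong_divisor_sums[OF cop _ assms(1) that])
    fix l assume l: "l dvd n" "odd l"
    then have "M dvd ?l l - ?l 1 - 2 ^ c * (int l - int 1)"
      using dvd_le by (intro diff) auto
    moreover have "M dvd 2 ^ c * (int l - int 1)" using l by (intro M_even) simp
    ultimately have "M dvd ?l l - ?l 1" by (simp add: dvd_diff_left_iff)
    then show "M dvd (\<Sum>d | d dvd l \<and> d \<noteq> 1. int d * ?K d)"
      using eigenvalue_minus_one[OF assms(1) l(1)] by simp
  qed
  have even_sum: "M dvd (\<Sum>d | d dvd l. int d * (2 * ?K (2 * d))) - 2 ^ c * int l"
    if l: "l dvd n" "odd l" for l
  proof -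
    have "M dvd ?l (2 * l) - ?l l - 2 ^ c * (int (2 * l) - int l)"
      using l dvd_le even_le by (intro diff) auto
    then show ?thesis using l assms by (simp add: eigenvalue_even_minus_odd)
  qed
  have K2: "M dvd 2 * ?K 2 - 2 ^ c" using even_sum[of 1] by simp
  have even_coeff: "M dvd 2 * ?K (2 * r)" if "r dvd n" "odd r" "r \<noteq> 1" for r
  proof (rule cong_coeffs_of_cong_divisor_sums[OF cop _ assms(1) that])
    fix l assume l: "l dvd n" "odd l"
    have "l > 0" using l by (auto intro: Nat.gr0I)
    have "{d. d dvd l} - {1} = {d. d dvd l \<and> d \<noteq> 1}" by auto
    then have "(\<Sum>d | d dvd l. int d * (2 * ?K (2 * d))) =
        2 * ?K 2 + (\<Sum>d | d dvd l \<and> d \<noteq> 1. int d * (2 * ?K (2 * d)))"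
      using \<open>l > 0\<close> by (simp add: sum.remove[of "{d. d dvd l}" 1])
    \<comment> \<open>The term \<open>d = 1\<close> carries the residue \<open>2 ^ c\<close>.
      Removing it leaves \<open>2 ^ c * (l - 1)\<close>, a multiple of \<open>M\<close> since
      \<open>l\<close> is odd.\<close>
    then have "(\<Sum>d | d dvd l \<and> d \<noteq> 1. int d * (2 * ?K (2 * d))) =
        ((\<Sum>d | d dvd l. int d * (2 * ?K (2 * d))) - 2 ^ c * int l) - (2 * ?K 2 - 2 ^ c)
          + 2 ^ c * (int l - 1)"
      by (simp add: algebra_simps)
    moreover have "M dvd \<dots>"
      by (intro dvd_add[OF dvd_diff[OF even_sum[OF l] K2]] M_even) (use l in simp)
    ultimately show "M dvd (\<Sum>d | d dvd l \<and> d \<noteq> 1. int d * (2 * ?K (2 * d)))" by simp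
  qed
  have "c \<noteq> 0"
  proof
    assume "c = 0"
    with K2 show False by (simp add: M_def)
  qed
  \<comment> \<open>Divisibility by 4 is enough below: a difference of two values in {0, 1}, even
    when doubled, is then 0.\<close>
  then have "4 dvd M" by (cases c) (auto simp: M_def)
  have F01: "?F q \<in> {0, 1}" for q by (simp add: icg_codivisor_def)
  have odd_twice: "\<exists>e. d = 2 * e \<and> odd e \<and> (\<forall>s. 2 * s dvd d \<longrightarrow> s dvd e)"
    if "2 * q dvd d" "odd q" "\<not> 4 * q dvd d" for d q :: nat
  proof -
    have "2 dvd d" using that(1) by (rule dvd_mult_left)
    then obtain e where e: "d = 2 * e" by (rule evenE)
    with that have "q dvd e" "\<not> 2 * q dvd e" by auto
    then have "odd e" using divides_mult[of 2 e q] \<open>odd q\<close> by simp blast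
    with e show ?thesis by auto
  qed

  show "?F r = ?F (2 * r)" if r: "odd r" "r \<noteq> 1"
  proof -
    have "M dvd ?F r - ?F (2 * r)"
      unfolding sum_icg_coeff_not_twice_dvd[OF assms(1)]
    proof (rule dvd_sum, elim CollectE conjE)
      fix d assume d: "d dvd n" "r dvd d" "\<not> 2 * r dvd d"
      then have "odd d" using r by (auto intro: divides_mult)
      with d r show "M dvd ?K d" by (intro odd_coeff) auto
    qed
    with \<open>4 dvd M\<close> have "4 dvd ?F r - ?F (2 * r)" by (rule dvd_trans)
    then show ?thesis using F01[of r] F01[of "2 * r"] by auto
  qed

  show "?F (2 * r) = ?F (4 * r)" if r: "odd r" "r \<noteq> 1"
  proof -
    have "M dvd 2 * (?F (2 * r) - ?F (2 * (2 * r)))"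
      unfolding sum_icg_coeff_not_twice_dvd[OF assms(1)] sum_distrib_left
    proof (rule dvd_sum, elim CollectE conjE)
      fix d assume d: "d dvd n" "2 * r dvd d" "\<not> 2 * (2 * r) dvd d"
      then obtain e where e: "d = 2 * e" "odd e" "r dvd e" using odd_twice[of r d] r by auto
      then have "e dvd n" "e \<noteq> 1" using d r dvd_mult_right[of 2 e n] by auto
      with e show "M dvd 2 * ?K d" using even_coeff[of e] by simp
    qed
    with \<open>4 dvd M\<close> have "4 dvd 2 * (?F (2 * r) - ?F (2 * (2 * r)))" by (rule dvd_trans)
    then show ?thesis using F01[of "2 * r"] F01[of "4 * r"] by auto
  qed

  show "?F 2 \<noteq> ?F 4"
  proof
    \<comment> \<open>Equality would make the doubled coefficient sum vanish. Its term at 2 is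
      \<open>2 ^ c\<close> modulo \<open>M\<close> and all others are 0, so
      \<open>M = 2 ^ Suc c\<close> would divide \<open>2 ^ c\<close>.\<close>
    assume F24: "?F 2 = ?F 4"
    let ?S = "{d. d dvd n \<and> 2 dvd d \<and> \<not> 4 dvd d}"
    have "0 = 2 * (\<Sum>d\<in>?S. ?K d)"
      using sum_icg_coeff_not_twice_dvd[OF assms(1), of D 2] F24 by simp
    also have "(\<Sum>d\<in>?S. ?K d) = ?K 2 + (\<Sum>d\<in>?S - {2}. ?K d)"
      using assms by (intro sum.remove) auto
    finally have eq: "2 ^ c = - ((2 * ?K 2 - 2 ^ c) + (\<Sum>d\<in>?S - {2}. 2 * ?K d))"
      by (simp add: sum_distrib_left)
    have "M dvd (\<Sum>d\<in>?S - {2}. 2 * ?K d)"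
    proof (rule dvd_sum)
      fix d assume d: "d \<in> ?S - {2}"
      then obtain e where e: "d = 2 * e" "odd e" using odd_twice[of 1 d] by auto
      then have "e dvd n" "e \<noteq> 1" using d dvd_mult_right[of 2 e n] by auto
      with e show "M dvd 2 * ?K d" using even_coeff[of e] by simp
    qed
    with K2 have "M dvd 2 ^ c" by (subst eq) (simp only: dvd_minus_iff dvd_add)
    then show False by (simp add: M_def)
  qed
qed

text \<open>Downward induction on \<open>r\<close>: the coefficients at the odd multiples of
  \<open>u * r\<close> sum to 0, and all of them beyond \<open>u * r\<close> itself vanish already.
  It is applied with \<open>u = 1\<close> and \<open>u = 2\<close>.\<close>

lemma coeff_eq_0_if_codivisor_eq:
  assumes "n > 0" "u > 0" "odd r" "r \<noteq> 1"
    and "\<And>s. odd s \<Longrightarrow> s \<noteq> 1 \<Longrightarrow> icg_codivisor n D (u * s) = icg_codivisor n D (2 * (u * s))"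
    and "u * r dvd n"
  shows "icg_coeff n D (u * r) = 0"
  using assms(3,4,6)
proof (induction "n - r" arbitrary: r rule: less_induct)
  case less
  let ?S = "{d. d dvd n \<and> u * r dvd d \<and> \<not> 2 * (u * r) dvd d}"
  have "u * r > 0" using less.prems assms by (auto intro: Nat.gr0I)
  have "(\<Sum>d\<in>?S - {u * r}. icg_coeff n D d) = 0"
  proof (intro sum.neutral ballI)
    fix d assume d: "d \<in> ?S - {u * r}"
    then obtain k where k: "d = u * r * k" by blast
    have "odd k" "k \<noteq> 1" using d k \<open>u * r > 0\<close> by auto
    then have "r < r * k" using less.prems by (cases k) (auto intro: Nat.gr0I)
    \<comment> \<open>These bounds give \<open>r < n\<close>, so that the truncated measure
      \<open>n - r\<close> really drops.\<close>
    moreover have "d \<le> n" "r * k \<le> d"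
      using d k assms by (auto intro: dvd_imp_le)
    ultimately have "n - r * k < n - r" by linarith
    moreover have "odd (r * k)" using less.prems \<open>odd k\<close> by simp
    moreover have "r * k \<noteq> 1" using less.prems by simp
    moreover have "u * (r * k) dvd n" using d k by (simp add: mult.assoc)
    ultimately have "icg_coeff n D (u * (r * k)) = 0" by (rule less.hyps)
    then show "icg_coeff n D d = 0" using k by (simp add: mult.assoc)
  qed
  moreover have "(\<Sum>d\<in>?S. icg_coeff n D d) = 0"
    using sum_icg_coeff_not_twice_dvd[OF assms(1), of D "u * r"] assms(5) less.prems by simp
  moreover have "(\<Sum>d\<in>?S. icg_coeff n D d) =
      icg_coeff n D (u * r) + (\<Sum>d\<in>?S - {u * r}. icg_coeff n D d)"
    using assms less.prems \<open>u * r > 0\<close> by (intro sum.remove) (auto dest: dvd_imp_le)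
  ultimately show ?case by simp
qed

text \<open>Modulo 4 only \<open>d = 1\<close> and \<open>d = 2\<close> survive: other odd or
  twice-odd divisors have coefficient 0, and multiples of 4 vanish through the factor
  \<open>d\<close>. Since \<open>K 2\<close> is odd, the eigenvalue is \<open>K 1\<close>, plus 2
  for even \<open>j\<close>; adding \<open>2 * j\<close> evens this out.\<close>

lemma eigenvalues_cong_if_codivisor:
  assumes "n > 0" "4 dvd n" "icg_codivisor n D 2 \<noteq> icg_codivisor n D 4"
    and F1: "\<And>r. odd r \<Longrightarrow> r \<noteq> 1 \<Longrightarrow> icg_codivisor n D r = icg_codivisor n D (2 * r)"
    and F2: "\<And>r. odd r \<Longrightarrow> r \<noteq> 1 \<Longrightarrow> icg_codivisor n D (2 * r) = icg_codivisor n D (4 * r)"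
  shows "4 dvd icg_eigenvalue n D j + 2 * int j - (icg_coeff n D 1 + 2)"
proof -
  let ?K = "icg_coeff n D"
  have even: "even n" using assms(2) by (auto elim: dvd_trans[rotated])
  have K_odd: "?K d = 0" if "d dvd n" "odd d" "d \<noteq> 1" for d
    using coeff_eq_0_if_codivisor_eq[OF assms(1), of 1 d D] F1 that by simp
  have K_even: "?K d = 0" if "d dvd n" "even d" "\<not> 4 dvd d" "d \<noteq> 2" for d
  proof -
    from \<open>even d\<close> obtain e where e: "d = 2 * e" by (rule evenE)
    with that show ?thesis
      using coeff_eq_0_if_codivisor_eq[OF assms(1), of 2 e D] F2 by auto
  qed
  have "icg_codivisor n D 2 - icg_codivisor n D 4 =
      (\<Sum>d | d dvd n \<and> 2 dvd d \<and> \<not> 4 dvd d. ?K d)"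
    using sum_icg_coeff_not_twice_dvd[OF assms(1), of D 2] by simp
  also have "\<dots> = (\<Sum>d\<in>{2}. ?K d)"
    using assms even by (intro sum.mono_neutral_right) (auto simp: K_even)
  finally have "?K 2 = 1 \<or> ?K 2 = -1"
    using assms(3) by (auto simp: icg_codivisor_def of_bool_def split: if_splits)
  then have K2: "odd (?K 2)" by auto
  \<comment> \<open>A model sum with the expected residues as weights, to be compared with the
    eigenvalue term by term.\<close>
  have "(\<Sum>d | d dvd n \<and> d dvd j. (if d = 1 then ?K 1 else if d = 2 then 2 else 0)) =
      (\<Sum>d\<in>{1} \<union> (if even j then {2} else {} :: nat set). (if d = 1 then ?K 1 else if d = 2 then 2 else 0))"
    using assms(1) even by (intro sum.mono_neutral_right) (auto split: if_splits)
  also have "\<dots> = ?K 1 + 2 * of_bool (even j)" by simp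
  finally have "icg_eigenvalue n D j - (?K 1 + 2 * of_bool (even j)) =
     (\<Sum>d | d dvd n \<and> d dvd j. int d * ?K d - (if d = 1 then ?K 1 else if d = 2 then 2 else 0))"
    by (simp add: icg_eigenvalue_def sum_subtractf)
  also have "4 dvd \<dots>"
  proof (rule dvd_sum, elim CollectE conjE)
    fix d assume d: "d dvd n" "d dvd j"
    consider "d = 1" | "d = 2" | "odd d" "d \<noteq> 1" | "even d" "\<not> 4 dvd d" "d \<noteq> 2" | "4 dvd d"
      by blast
    then show "4 dvd int d * ?K d - (if d = 1 then ?K 1 else if d = 2 then 2 else 0)"
    proof cases
      case 2
      with K2 show ?thesis by (auto elim!: oddE)
    next
      case 5
      then have "4 dvd int d" by presburger
      with 5 show ?thesis by auto
    qed (use d K_odd K_even in auto)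
  qed
  finally show ?thesis
    by (cases "even j") (auto elim!: evenE oddE, presburger+)
qed


section \<open>Perfect state transfer and eigenvalue phases\<close>

text \<open>Equality case of the triangle inequality: the inner products of the \<open>z j\<close>
  with the total \<open>w\<close> are at most \<open>n\<close> and add up to \<open>n * n\<close>,
  so each attains equality in Cauchy-Schwarz.\<close>

lemma unit_summands_eq_if_norm_sum_eq:
  fixes z :: "nat \<Rightarrow> complex"
  assumes "\<And>j. j < n \<Longrightarrow> cmod (z j) = 1" "cmod (\<Sum>j<n. z j) = real n" "j < n"
  shows "of_nat n * z j = (\<Sum>j<n. z j)"
proof -
  define w where "w = (\<Sum>j<n. z j)"
  have w: "cmod w = real n" using assms(2) by (simp add: w_def)
  have "(\<Sum>j<n. z j \<bullet> w) = w \<bullet> w" by (simp add: w_def inner_sum_left)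
  also have "\<dots> = (\<Sum>j<n. real n)" using w by (simp add: dot_square_norm power2_eq_square)
  finally have "z j \<bullet> w = real n"
  proof (rule sum_mono_inv)
    fix i assume "i \<in> {..<n}"
    then show "z i \<bullet> w \<le> real n" using norm_cauchy_schwarz[of "z i" w] assms(1) w by simp
  qed (use assms(3) in auto)
  then have "z j \<bullet> w = cmod (z j) * cmod w" using assms w by simp
  then have "cmod (z j) *\<^sub>R w = cmod w *\<^sub>R z j" by (simp only: norm_cauchy_schwarz_eq)
  then show ?thesis using assms w by (simp add: w_def scaleR_conv_of_real)
qed

text \<open>An entry of norm 1 is an average of \<open>n\<close> unit numbers, so all of them agree.
  Comparing the indices \<open>n - 1\<close> and 1 locates the vertices, and comparing
  \<open>j\<close> with 0 gives the phases.\<close>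

lemma pst_phases:
  assumes "has_pst n D"
  obtains t where "even n" "n > 0"
    "\<And>j. j \<le> n \<Longrightarrow> cis (t * of_int (icg_eigenvalue n D j - icg_eigenvalue n D 0)) = (-1) ^ j"
proof -
  let ?l = "icg_eigenvalue n D"
  from assms obtain a b t where ab: "a < n" "b < n" "a \<noteq> b"
    and t: "cmod (icg_transfer n D t $$ (a, b)) = 1"
    by (auto simp: has_pst_def icg_vertices_def)
  define x where "x = int a - int b"
  define z where "z j = cis (t * of_int (?l j)) * root_char n (int j * x)" for j
  have n: "n \<ge> 2" using ab by linarith
  have "icg_transfer n D t $$ (a, b) = (\<Sum>j<n. z j) / of_nat n"
    using ab by (simp add: icg_transfer_entry z_def x_def)
  then have "cmod (\<Sum>j<n. z j) / real n = 1"
    using t by (simp only: norm_divide norm_of_nat)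
  then have "cmod (\<Sum>j<n. z j) = real n" using n by simp
  then have sum_z: "of_nat n * z j = (\<Sum>j<n. z j)" if "j < n" for j
    using that by (intro unit_summands_eq_if_norm_sum_eq) (simp_all add: z_def norm_mult)
  have z: "z j = z 0" if "j < n" for j
  proof -
    have "of_nat n * z j = of_nat n * z 0" using sum_z[OF that] sum_z[of 0] n by (simp only:)
    then show ?thesis using n by simp
  qed
  \<comment> \<open>The equality \<open>\<lambda>\<^sub>n\<^sub>-\<^sub>1 = \<lambda>\<^sub>1\<close> forces \<open>n\<close> to divide \<open>2x\<close>, so the vertices are antipodal.\<close>
  have "d dvd n - 1 \<longleftrightarrow> d dvd 1" if "d dvd n" for d
    using dvd_diff_nat[OF that, of "n - 1"] n by auto
  then have "{d. d dvd n \<and> d dvd n - 1} = {d. d dvd n \<and> d dvd 1}" by blast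
  then have "?l (n - 1) = ?l 1" by (simp add: icg_eigenvalue_def)
  moreover have "z (n - 1) = z 1" using z[of "n - 1"] z[of 1] n by simp
  ultimately have "root_char n (int (n - 1) * x) = root_char n x" by (simp add: z_def)
  moreover have "int (n - 1) * x = int n * x - 2 * x + x" using n by (simp add: of_nat_diff algebra_simps)
  ultimately have "root_char n (int n * x - 2 * x) * root_char n x = root_char n x"
    by (simp only: root_char_add)
  then have "root_char n (int n * x - 2 * x) = 1" by (simp add: root_char_def)
  then have "int n dvd int n * x - 2 * x" using n by (simp add: root_char_eq_1_iff)
  then have "int n dvd 2 * x" by (simp add: dvd_diff_right_iff)
  then obtain k where k: "2 * x = int n * k" by blast
  have "x \<noteq> 0" using ab by (simp add: x_def)
  have "\<bar>x\<bar> < int n" using ab by (auto simp: x_def)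
  moreover have "2 * \<bar>x\<bar> = int n * \<bar>k\<bar>" using arg_cong[OF k, of abs] by (simp add: abs_mult)
  ultimately have "int n * \<bar>k\<bar> < int n * 2" by simp
  then have "\<bar>k\<bar> < 2" using n by simp
  moreover have "k \<noteq> 0" using k \<open>x \<noteq> 0\<close> by auto
  ultimately have k1: "k = 1 \<or> k = -1" by linarith
  then have "int n = 2 * x \<or> int n = 2 * (- x)" using k by auto
  then have "even (int n)" by (metis dvd_triv_left)
  then have "even n" by simp
  have "root_char n x = cis (pi * of_int k)"
  proof -
    have "2 * real_of_int x = real n * of_int k" using k by (metis of_int_mult of_int_numeral of_int_of_nat_eq)
    then show ?thesis using n by (simp add: root_char_def field_simps)
  qed
  then have x: "root_char n x = -1" using k1 by (auto simp: complex_eq_iff)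
  have phase: "cis (t * of_int (?l j - ?l 0)) = (-1) ^ j" if "j < n" for j
  proof -
    have "cis (t * of_int (?l j)) * (-1) ^ j = cis (t * of_int (?l 0))"
      using z[OF that] by (simp add: z_def x flip: root_char_power)
    then have "cis (t * of_int (?l j)) = cis (t * of_int (?l 0)) * (-1) ^ j"
      by (cases "even j") (simp_all add: minus_equation_iff)
    then show ?thesis by (simp add: right_diff_distrib flip: cis_divide)
  qed
  \<comment> \<open>The index \<open>j = n\<close> is included because the congruences are later
    used at \<open>2 * l\<close>, which may equal \<open>n\<close>.\<close>
  have "{d. d dvd n \<and> d dvd n} = {d. d dvd n \<and> d dvd 0}" by simp
  then have "?l n = ?l 0" by (simp add: icg_eigenvalue_def)
  then have "cis (t * of_int (?l j - ?l 0)) = (-1) ^ j" if "j \<le> n" for j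
    using phase that \<open>even n\<close> by (cases "j = n") auto
  with that \<open>even n\<close> n show thesis by auto
qed

text \<open>Each phase says \<open>t * m j = pi * w\<close> with \<open>w\<close> of the parity of
  \<open>j\<close>. Cross-multiplying with the relation at \<open>j = 1\<close> eliminates
  \<open>t\<close> and \<open>pi\<close>; as \<open>w1\<close> is odd, \<open>m j\<close> is
  \<open>2 ^ c\<close> times a number of the parity of \<open>j\<close>, where \<open>c\<close> is
  the 2-adic valuation of \<open>m 1\<close>.\<close>

lemma cong_of_alternating_phases:
  fixes m :: "nat \<Rightarrow> int" and t :: real
  assumes "n \<ge> 1" "\<And>j. j \<le> n \<Longrightarrow> cis (t * of_int (m j)) = (-1) ^ j"
  obtains c where "\<And>j. j \<le> n \<Longrightarrow> 2 ^ Suc c dvd m j - 2 ^ c * int j"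
proof -
  have ex: "\<exists>w. t * of_int (m j) = pi * of_int w \<and> even (w - int j)" if "j \<le> n" for j
  proof -
    have "cis (pi * real j) = (-1) ^ j"
      using Complex.DeMoivre[of pi j] by (simp add: mult.commute)
    then have "cis (t * of_int (m j) - pi * real j) = 1"
      using assms(2)[OF that] by (simp flip: cis_divide)
    then have "cos (t * of_int (m j) - pi * real j) = 1" by (simp add: complex_eq_iff)
    then obtain k where "t * of_int (m j) - pi * real j = of_int k * 2 * pi"
      using cos_one_2pi_int by blast
    then have "t * of_int (m j) = pi * of_int (int j + 2 * k)" by (simp add: algebra_simps)
    then show ?thesis by (metis add_diff_cancel_left' dvd_triv_left)
  qed
  from ex[OF assms(1)] obtain w1 where w1: "t * of_int (m 1) = pi * of_int w1" "odd w1" by auto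
  then have nz: "t \<noteq> 0" "m 1 \<noteq> 0" by auto
  obtain u where u: "m 1 = 2 ^ multiplicity 2 (m 1) * u" "odd u"
    using multiplicity_decompose'[of "m 1" 2] nz by auto
  define c where "c = multiplicity 2 (m 1)"
  have "2 ^ Suc c dvd m j - 2 ^ c * int j" if j: "j \<le> n" for j
  proof -
    from ex[OF j] obtain w where w: "t * of_int (m j) = pi * of_int w" "even (w - int j)" by auto
    have "(t * pi) * (of_int (m j) * of_int w1) = (t * of_int (m j)) * (pi * of_int w1)" by simp
    also have "\<dots> = (pi * of_int w) * (t * of_int (m 1))" by (simp only: w w1)
    also have "\<dots> = (t * pi) * (of_int w * of_int (m 1))" by simp
    finally have "real_of_int (m j) * of_int w1 = of_int w * of_int (m 1)"
      using nz by simp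
    then have eq: "m j * w1 = w * m 1" by (metis of_int_eq_iff of_int_mult)
    then have "2 ^ c dvd m j * w1" by (metis u(1) c_def dvd_mult dvd_triv_left)
    moreover have "coprime (2 ^ c) w1" using w1 by simp
    ultimately have "2 ^ c dvd m j" using coprime_dvd_mult_left_iff by blast
    then obtain s where s: "m j = 2 ^ c * s" by blast
    have "2 ^ c * (s * w1) = 2 ^ c * (w * u)"
      using eq u(1) s unfolding c_def[symmetric] by (simp add: mult_ac)
    then have "s * w1 = w * u" by simp
    then have "even s \<longleftrightarrow> even w" using w1 u by (metis even_mult_iff)
    then have "even (s - int j)" using w by simp
    then obtain v where "s - int j = 2 * v" by blast
    then have "m j - 2 ^ c * int j = 2 ^ Suc c * v" using s by (simp flip: right_diff_distrib)
    then show ?thesis by simp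
  qed
  then show thesis by (rule that)
qed

text \<open>For the vertices \<open>n div 2\<close> and 0 at time \<open>pi / 2\<close>, the
  character contributes \<open>(-1) ^ j\<close>, a shift of the eigenvalue by \<open>2 * j\<close>.
  All summands then share the phase \<open>cis (pi / 2 * s)\<close>.\<close>

lemma has_pst_if_eigenvalues_cong:
  assumes "n > 0" "even n" "\<And>j. 4 dvd icg_eigenvalue n D j + 2 * int j - s"
  shows "has_pst n D"
proof -
  have phase: "cis (pi / 2 * of_int (icg_eigenvalue n D j)) * root_char n (int j * (int (n div 2) - int 0)) =
      cis (pi / 2 * of_int s)" for j
  proof -
    obtain k where "icg_eigenvalue n D j + 2 * int j - s = 4 * k" using assms(3)[of j] by blast
    then have k: "icg_eigenvalue n D j + 2 * int j = s + 4 * k" by simp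
    have "2 * pi * real_of_int (int j * (int (n div 2) - int 0)) / real n = pi * real j"
      using assms by (auto elim!: evenE)
    then have "cis (pi / 2 * of_int (icg_eigenvalue n D j)) * root_char n (int j * (int (n div 2) - int 0)) =
        cis (pi / 2 * of_int (icg_eigenvalue n D j + 2 * int j))"
      by (simp only: root_char_def cis_mult) (simp add: algebra_simps)
    also have "\<dots> = cis (pi / 2 * of_int s) * cis (2 * pi * of_int k)"
      unfolding k by (simp only: cis_mult) (simp add: algebra_simps)
    also have "\<dots> = cis (pi / 2 * of_int s)"
      by (simp only: cis_multiple_2pi[OF Ints_of_int] mult_1_right)
    finally show ?thesis .
  qed
  have lt: "0 < n" "n div 2 < n" "n div 2 \<noteq> 0" using assms by (auto elim!: evenE)
  have "icg_transfer n D (pi / 2) $$ (n div 2, 0) = cis (pi / 2 * of_int s)"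
    using lt by (simp only: icg_transfer_entry phase) simp
  then have "cmod (icg_transfer n D (pi / 2) $$ (n div 2, 0)) = 1" by simp
  with lt show ?thesis
    unfolding has_pst_def icg_vertices_def
    by (intro bexI[of _ "n div 2"] bexI[of _ 0] conjI exI[of _ "pi / 2"]) auto
qed

section \<open>Translation to the divisor classes\<close>

text \<open>Class \<open>i\<close> is parametrized by the odd part \<open>r\<close> of
  \<open>n div d\<close>, whose 2-part is \<open>2 ^ i\<close>.\<close>

lemma div_class_eq_image:
  assumes "n > 0" "D \<subseteq> {d. d dvd n}"
  shows "div_class n D i = (\<lambda>r. n div (2 ^ i * r)) ` {r. odd r \<and> icg_codivisor n D (2 ^ i * r) = 1}"
proof (intro equalityI subsetI)
  fix d assume "d \<in> div_class n D i"
  then have d: "d \<in> D" "multiplicity 2 (n div d) = i" by (auto simp: div_class_def S2_def)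
  then have "d dvd n" using assms by auto
  then have nd: "n div d dvd n" "n div (n div d) = d" "n div d \<noteq> 0" using assms by auto
  obtain r where "n div d = 2 ^ i * r" "odd r"
    using multiplicity_decompose'[of "n div d" 2] nd(3) d(2) by auto
  then show "d \<in> (\<lambda>r. n div (2 ^ i * r)) ` {r. odd r \<and> icg_codivisor n D (2 ^ i * r) = 1}"
    using nd d by (intro image_eqI[of _ _ r]) (auto simp: icg_codivisor_def)
next
  fix d assume "d \<in> (\<lambda>r. n div (2 ^ i * r)) ` {r. odd r \<and> icg_codivisor n D (2 ^ i * r) = 1}"
  then obtain r where r: "odd r" "2 ^ i * r dvd n" "n div (2 ^ i * r) \<in> D" "d = n div (2 ^ i * r)"
    by (auto simp: icg_codivisor_def)
  then have "n div d = 2 ^ i * r" using assms by auto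
  moreover have "multiplicity 2 (2 ^ i * r) = i"
    using r by (intro multiplicity_eqI) (auto simp: mult_ac)
  ultimately show "d \<in> div_class n D i" using r by (simp add: div_class_def S2_def)
qed

lemma inj_on_div: "n > 0 \<Longrightarrow> u > 0 \<Longrightarrow> inj_on (\<lambda>r. n div (u * r)) {r :: nat. u * r dvd n}"
  by (rule inj_onI) (metis mem_Collect_eq dvd_mult_div_cancel
      mult_cancel_left nat_mult_eq_cancel1 neq0_conv dvd_div_mult_self mult_0_right)

text \<open>Removing the starred element amounts to \<open>r \<noteq> 1\<close>. Scaling by
  \<open>k\<close> with \<open>4 = k * u\<close> turns \<open>n div (4 * r)\<close> into
  \<open>n div (u * r)\<close>, so both sides are images under one injective map and only their
  index sets need comparing.\<close>

lemma pst_sets_iff_codivisor: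
  assumes "n > 0" "4 dvd n" "D \<subseteq> {d. d dvd n \<and> 1 \<le> d \<and> d < n}"
  shows "D1_star n D = set_scale 2 (D2_star n D) \<longleftrightarrow>
      (\<forall>r. odd r \<and> r \<noteq> 1 \<longrightarrow> icg_codivisor n D (2 * r) = icg_codivisor n D (4 * r))"
    and "div_class n D 0 = set_scale 4 (D2_star n D) \<longleftrightarrow>
      (\<forall>r. odd r \<and> r \<noteq> 1 \<longrightarrow> icg_codivisor n D r = icg_codivisor n D (4 * r))"
proof -
  let ?F = "icg_codivisor n D"
  let ?R = "\<lambda>u. {r. odd r \<and> r \<noteq> 1 \<and> ?F (u * r) = 1}"
  have D: "D \<subseteq> {d. d dvd n}" using assms by auto
  have F_eq: "?F a = ?F b \<longleftrightarrow> (?F a = 1 \<longleftrightarrow> ?F b = 1)" for a b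
    by (auto simp: icg_codivisor_def)
  have dvd: "q dvd n" if "?F q = 1" for q using that by (auto simp: icg_codivisor_def split: if_splits)
  have four: "4 * r dvd n" if "odd r" "u * r dvd n" for u r
  proof -
    have "coprime (2 ^ 2) r" using that by (simp only: coprime_power_left_iff) simp
    then have "coprime 4 r" by simp
    with that assms show ?thesis by (auto intro: divides_mult dvd_mult_right)
  qed
  have star: "(\<lambda>r. n div (u * r)) ` {r. odd r \<and> ?F (u * r) = 1} - {n div u} =
      (\<lambda>r. n div (u * r)) ` ?R u" if "u dvd n" for u
  proof -
    have "u > 0" using that assms by (auto intro: Nat.gr0I)
    then have "n div (u * r) \<noteq> n div u" if "r \<noteq> 1" "?F (u * r) = 1" for r
      using inj_onD[OF inj_on_div[OF assms(1), of u], of r 1] that dvd[of "u * r"] \<open>u dvd n\<close> by auto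
    then show ?thesis by (auto 0 3)
  qed
  have "2 dvd n" using assms(2) by (rule dvd_trans[rotated]) simp
  have D1: "D1_star n D = (\<lambda>r. n div (2 * r)) ` ?R 2"
    using div_class_eq_image[OF assms(1) D, of 1] star[OF \<open>2 dvd n\<close>] by (simp add: D1_star_def)
  have D2: "D2_star n D = (\<lambda>r. n div (4 * r)) ` ?R 4"
    using div_class_eq_image[OF assms(1) D, of 2] star[OF assms(2)] by (simp add: D2_star_def)
  \<comment> \<open>Since \<open>n\<close> is not in \<open>D\<close>, class 0 omits
    \<open>r = 1\<close> by itself.\<close>
  have "?F 1 \<noteq> 1" using assms by (auto simp: icg_codivisor_def)
  then have "{r. odd r \<and> ?F r = 1} = ?R 1" by auto
  then have D0: "div_class n D 0 = (\<lambda>r. n div (1 * r)) ` ?R 1"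
    using div_class_eq_image[OF assms(1) D, of 0] by simp
  have scale: "set_scale k (D2_star n D) = (\<lambda>r. n div (u * r)) ` ?R 4"
    if "4 = k * u" "u > 0" for k u
  proof -
    have "k * (n div (4 * r)) = n div (u * r)" if "4 * r dvd n" for r
    proof -
      obtain e where "n = 4 * r * e" using \<open>4 * r dvd n\<close> by blast
      then have "n = (k * u) * r * e" by (simp only: \<open>4 = k * u\<close>)
      then have e: "n = u * r * (k * e)" "n = 4 * r * e"
        using \<open>n = 4 * r * e\<close> by (simp_all only: mult_ac)
      then have "r > 0" using assms by (auto intro: Nat.gr0I)
      have "n div (u * r) = k * e" unfolding e(1) using \<open>r > 0\<close> \<open>u > 0\<close> by simp
      moreover have "n div (4 * r) = e" unfolding e(2) using \<open>r > 0\<close> by simp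
      ultimately show ?thesis by simp
    qed
    then have "(\<lambda>x. k * x) ` (\<lambda>r. n div (4 * r)) ` ?R 4 = (\<lambda>r. n div (u * r)) ` ?R 4"
      unfolding image_image using dvd by (intro image_cong) auto
    then show ?thesis by (auto simp: set_scale_def D2)
  qed
  have eq: "(\<lambda>r. n div (u * r)) ` ?R u = (\<lambda>r. n div (u * r)) ` ?R 4 \<longleftrightarrow>
      (\<forall>r. odd r \<and> r \<noteq> 1 \<longrightarrow> ?F (u * r) = ?F (4 * r))" if "u dvd 4" for u
  proof -
    have "u > 0" using that by (auto intro: Nat.gr0I)
    have "u * r dvd n" if "4 * r dvd n" for r
      using \<open>u dvd 4\<close> that by (meson dvd_trans mult_dvd_mono dvd_refl)
    then have sub: "?R u \<subseteq> {r. u * r dvd n}" "?R 4 \<subseteq> {r. u * r dvd n}"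
      using dvd by auto
    have "(\<lambda>r. n div (u * r)) ` ?R u = (\<lambda>r. n div (u * r)) ` ?R 4 \<longleftrightarrow> ?R u = ?R 4"
      by (rule inj_on_image_eq_iff[OF inj_on_div[OF assms(1) \<open>u > 0\<close>] sub])
    also have "\<dots> \<longleftrightarrow> (\<forall>r. odd r \<and> r \<noteq> 1 \<longrightarrow> ?F (u * r) = ?F (4 * r))"
      unfolding F_eq by blast
    finally show ?thesis .
  qed
  have scale2: "set_scale 2 (D2_star n D) = (\<lambda>r. n div (2 * r)) ` ?R 4"
    by (rule scale[of 2 2]) simp_all
  have scale4: "set_scale 4 (D2_star n D) = (\<lambda>r. n div (1 * r)) ` ?R 4"
    by (rule scale[of 4 1]) simp_all
  show "D1_star n D = set_scale 2 (D2_star n D) \<longleftrightarrow>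
      (\<forall>r. odd r \<and> r \<noteq> 1 \<longrightarrow> ?F (2 * r) = ?F (4 * r))"
    unfolding D1 scale2 by (rule eq[of 2]) simp
  show "div_class n D 0 = set_scale 4 (D2_star n D) \<longleftrightarrow>
      (\<forall>r. odd r \<and> r \<noteq> 1 \<longrightarrow> ?F r = ?F (4 * r))"
    using eq[of 1] unfolding D0 scale4 by simp
qed

section \<open>Combination of both directions, including the case where 4 does not divide
  \<open>n\<close>\<close>

theorem mainTheorem1:
  fixes n :: nat and D :: "nat set"
  assumes "n \<ge> 2"
    and "D \<subseteq> {d. d dvd n \<and> 1 \<le> d \<and> d < n}"
    and "\<not> (n mod 4 = 2 \<and> D = {n div 2})"
  shows "has_pst n D \<longleftrightarrow>
    4 dvd n \<and>
    D1_star n D = set_scale 2 (D2_star n D) \<and>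
    div_class n D 0 = set_scale 4 (D2_star n D) \<and>
    ((n div 4 \<in> D \<and> n div 2 \<notin> D) \<or> (n div 4 \<notin> D \<and> n div 2 \<in> D))"
proof -
  let ?F = "icg_codivisor n D"
  have n: "n > 0" using assms(1) by simp
  have necessary: "even n \<and> ?F 2 \<noteq> ?F 4 \<and>
      (\<forall>r. odd r \<and> r \<noteq> 1 \<longrightarrow> ?F r = ?F (2 * r) \<and> ?F (2 * r) = ?F (4 * r))" if pst: "has_pst n D"
  proof -
    obtain t where "even n" and t: "\<And>j. j \<le> n \<Longrightarrow>
        cis (t * of_int (icg_eigenvalue n D j - icg_eigenvalue n D 0)) = (-1) ^ j"
      using pst_phases[OF pst] by metis
    obtain c where c: "\<And>j. j \<le> n \<Longrightarrow>
        2 ^ Suc c dvd icg_eigenvalue n D j - icg_eigenvalue n D 0 - 2 ^ c * int j"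
      using cong_of_alternating_phases[OF _ t] n by (metis One_nat_def Suc_leI)
    from codivisor_if_eigenvalues_cong[OF n \<open>even n\<close> c] \<open>even n\<close> show ?thesis by blast
  qed
  show ?thesis
  proof (cases "4 dvd n")
    case True
    have even: "even n" using True by (rule dvd_trans[rotated]) simp
    have xor: "(n div 4 \<in> D \<and> n div 2 \<notin> D \<or> n div 4 \<notin> D \<and> n div 2 \<in> D) \<longleftrightarrow> ?F 2 \<noteq> ?F 4"
      using True even by (auto simp: icg_codivisor_def)
    have "has_pst n D" if "?F 2 \<noteq> ?F 4"
      "\<forall>r. odd r \<and> r \<noteq> 1 \<longrightarrow> ?F (2 * r) = ?F (4 * r)" "\<forall>r. odd r \<and> r \<noteq> 1 \<longrightarrow> ?F r = ?F (4 * r)"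
    proof (rule has_pst_if_eigenvalues_cong[OF n even])
      show "4 dvd icg_eigenvalue n D j + 2 * int j - (icg_coeff n D 1 + 2)" for j
        by (rule eigenvalues_cong_if_codivisor[OF n True]) (use that in auto)
    qed
    with necessary show ?thesis
      unfolding xor pst_sets_iff_codivisor[OF n True assms(2)] using True by metis
  next
    case False
    \<comment> \<open>Here \<open>F\<close> vanishes at all multiples of 4, so the necessary
      conditions leave \<open>q = 2\<close> as its only support. This forces
      \<open>D = {n div 2}\<close>, the excluded graph of disjoint edges.\<close>
    have "\<not> has_pst n D"
    proof
      assume "has_pst n D"
      note nec = necessary[OF this]
      have F4: "?F (4 * r) = 0" for r
        using False by (auto simp: icg_codivisor_def dest: dvd_mult_left)
      have "?F 2 \<noteq> 0" using nec F4[of 1] by simp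
      moreover have "?F r = 0 \<and> ?F (2 * r) = 0" if "odd r" "r \<noteq> 1" for r
        using nec F4[of r] that by simp
      ultimately have F: "?F 2 \<noteq> 0" "\<And>r. odd r \<Longrightarrow> r \<noteq> 1 \<Longrightarrow> ?F r = 0 \<and> ?F (2 * r) = 0"
        by blast+
      have "D = {n div 2}"
      proof (intro equalityI subsetI)
        fix d assume "d \<in> D"
        then have d: "d dvd n" "d \<noteq> n" using assms(2) by auto
        define q where "q = n div d"
        have q: "q dvd n" "n div q = d" "q \<noteq> 1" using d n by (auto simp: q_def)
        then have "?F q = 1" using \<open>d \<in> D\<close> by (simp add: icg_codivisor_def)
        have "q = 2"
        proof (cases "odd q")
          case True
          with F q \<open>?F q = 1\<close> show ?thesis by fastforce
        next
          case even: False
          then obtain r where r: "q = 2 * r" by blast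
          have "odd r" using r q(1) False by (auto elim!: evenE dest: dvd_mult_left)
          with F(2)[of r] r \<open>?F q = 1\<close> show ?thesis by fastforce
        qed
        with q show "d \<in> {n div 2}" by simp
      next
        fix d assume "d \<in> {n div 2}"
        with F(1) show "d \<in> D" by (auto simp: icg_codivisor_def)
      qed
      moreover have "n mod 4 = 2" using conjunct1[OF nec] False by presburger
      ultimately show False using assms(3) by blast
    qed
    with False show ?thesis by blast
  qed
qed

end
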